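(* Assume that: for every $y\in\mathcal{Y}$, $u\mapsto\ell(y,u)$ is convex on $\mathbb{R}^p$; there is $\rho_p\in(0,+\infty)$ such that for every $y\in\mathcal{Y}$, $u\mapsto\ell(y,u)$ is $\rho_p$-Lipschitz on $\mathbb{R}^p$ for the Euclidean norm; and there is $c_\ell\in\mathbb{R}$ such that $\ell(y,u)\ge c_\ell$ for all $(y,u)\in\mathbb{R}^p\times\mathbb{R}^p$. Let $\lambda\in(0,+\infty)$ and $\lambda^+:=\frac{n+1}{n}\lambda$. Then for every $y\in\mathcal{Y}$, $$\left\|\hat f_{\lambda;D^y}-\hat f_{\lambda^+;D}\right\|_{\mathcal{H}}\le\frac{\rho_p\,\|K(X_{n+1},X_{n+1})\|_{\mathrm{op}}^{1/2}}{2\lambda(n+1)}.$$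
   Context: $\mathcal{X}\subset\mathbb{R}^d$, $\mathcal{Y}\subset\mathbb{R}^p$, $(X_1,Y_1),\dots,(X_n,Y_n)\in\mathcal{X}\times\mathcal{Y}$, $X_{n+1}\in\mathcal{X}$. $\mathcal{H}$ is a reproducing kernel Hilbert space of functions $\mathcal{X}\to\mathbb{R}^p$ with matrix-valued kernel $K:\mathcal{X}\times\mathcal{X}\to\mathbb{R}^{p\times p}$: for all $x\in\mathcal{X}$, $v\in\mathbb{R}^p$, $K(\cdot,x)v\in\mathcal{H}$ and $\langle K(\cdot,x)v,f\rangle_{\mathcal{H}}=\langle v,f(x)\rangle$ for all $f\in\mathcal{H}$. $\|\cdot\|_{\mathrm{op}}$ is the matrix operator norm associated with the Euclidean norm. $\ell:\mathbb{R}^p\times\mathbb{R}^p\to\mathbb{R}$ is a loss function. For a finite data set $D'$ and $\lambda'>0$, $\hat f_{\lambda';D'}$ is the (unique) minimizer over $f\in\mathcal{H}$ of $\frac{1}{|D'|}\sum_{(x,y)\in D'}\ell(y,f(x))+\lambda'\|f\|_{\mathcal{H}}^2$. $D$ consists of $(X_1,Y_1),\dots,(X_n,Y_n)$; $D^y$ consists of these points together with $(X_{n+1},y)$. *)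

theory Defs
  imports "HOL-Analysis.Analysis"
begin

definition hnorm :: "(('a \<Rightarrow> 'b) \<Rightarrow> ('a \<Rightarrow> 'b) \<Rightarrow> real) \<Rightarrow> ('a \<Rightarrow> 'b) \<Rightarrow> real"
  where "hnorm ip f = sqrt (ip f f)"

definition fdiff :: "'a set \<Rightarrow> ('a \<Rightarrow> 'b::real_vector) \<Rightarrow> ('a \<Rightarrow> 'b) \<Rightarrow> ('a \<Rightarrow> 'b)"
  where "fdiff \<X> f g = (\<lambda>x\<in>\<X>. f x - g x)"

text \<open>
  A Hilbert space of functions \<open>\<X> \<rightarrow> 'b\<close>. Functions on \<open>\<X>\<close> are extensional (arbitrary but fixed
  outside \<open>\<X>\<close>), so that equality in the space is equality on \<open>\<X>\<close>; the vector space
  operations are the pointwise ones. Nothing is required of the inner product \<open>ip\<close>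
  outside the carrier \<open>\<H>\<close>.
\<close>

locale function_hilbert_space =
  fixes \<X> :: "'a set"
    and \<H> :: "('a \<Rightarrow> 'b::real_vector) set"
    and ip :: "('a \<Rightarrow> 'b) \<Rightarrow> ('a \<Rightarrow> 'b) \<Rightarrow> real"
  assumes carrier: "\<H> \<subseteq> \<X> \<rightarrow>\<^sub>E UNIV"
    and zero_closed: "(\<lambda>x\<in>\<X>. 0) \<in> \<H>"
    and add_closed: "f \<in> \<H> \<Longrightarrow> g \<in> \<H> \<Longrightarrow> (\<lambda>x\<in>\<X>. f x + g x) \<in> \<H>"
    and scale_closed: "f \<in> \<H> \<Longrightarrow> (\<lambda>x\<in>\<X>. c *\<^sub>R f x) \<in> \<H>"
    and ip_commute: "f \<in> \<H> \<Longrightarrow> g \<in> \<H> \<Longrightarrow> ip f g = ip g f"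
    and ip_add: "f \<in> \<H> \<Longrightarrow> g \<in> \<H> \<Longrightarrow> h \<in> \<H> \<Longrightarrow> ip (\<lambda>x\<in>\<X>. f x + g x) h = ip f h + ip g h"
    and ip_scale: "f \<in> \<H> \<Longrightarrow> g \<in> \<H> \<Longrightarrow> ip (\<lambda>x\<in>\<X>. c *\<^sub>R f x) g = c * ip f g"
    and ip_nonneg: "f \<in> \<H> \<Longrightarrow> 0 \<le> ip f f"
    and ip_definite: "f \<in> \<H> \<Longrightarrow> ip f f = 0 \<Longrightarrow> f = (\<lambda>x\<in>\<X>. 0)"
    and complete:
      "(\<And>k::nat. s k \<in> \<H>) \<Longrightarrow>
       (\<And>e. e > 0 \<Longrightarrow> \<exists>N. \<forall>i\<ge>N. \<forall>j\<ge>N. hnorm ip (fdiff \<X> (s i) (s j)) < e) \<Longrightarrow>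
       \<exists>f\<in>\<H>. (\<lambda>k. hnorm ip (fdiff \<X> (s k) f)) \<longlonglongrightarrow> 0"

text \<open>The function \<open>K(\<cdot>, x) v\<close> is \<open>\<lambda>z\<in>\<X>. K z x *v v\<close>.\<close>

locale vector_valued_rkhs = function_hilbert_space \<X> \<H> ip
  for \<X> :: "'a set"
    and \<H> :: "('a \<Rightarrow> real ^ 'p) set"
    and ip :: "('a \<Rightarrow> real ^ 'p) \<Rightarrow> ('a \<Rightarrow> real ^ 'p) \<Rightarrow> real" +
  fixes K :: "'a \<Rightarrow> 'a \<Rightarrow> real ^ 'p ^ 'p"
  assumes kernel_in: "x \<in> \<X> \<Longrightarrow> (\<lambda>z\<in>\<X>. K z x *v v) \<in> \<H>"
    and reproducing: "x \<in> \<X> \<Longrightarrow> f \<in> \<H> \<Longrightarrow> ip (\<lambda>z\<in>\<X>. K z x *v v) f = v \<bullet> f x"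

text \<open>
  Data sets are lists of pairs, so repeated points are counted with multiplicity and
  \<open>|D|\<close> is the length of the list.
\<close>

definition reg_risk ::
    "(('a \<Rightarrow> 'b) \<Rightarrow> ('a \<Rightarrow> 'b) \<Rightarrow> real) \<Rightarrow> ('c \<Rightarrow> 'b \<Rightarrow> real) \<Rightarrow> real \<Rightarrow> ('a \<times> 'c) list
      \<Rightarrow> ('a \<Rightarrow> 'b) \<Rightarrow> real"
  where "reg_risk ip loss lam D f =
    (1 / real (length D)) * (\<Sum>(x, y)\<leftarrow>D. loss y (f x)) + lam * (hnorm ip f)\<^sup>2"

definition reg_minimizer ::
    "('a \<Rightarrow> 'b) set \<Rightarrow> (('a \<Rightarrow> 'b) \<Rightarrow> ('a \<Rightarrow> 'b) \<Rightarrow> real) \<Rightarrow> ('c \<Rightarrow> 'b \<Rightarrow> real) \<Rightarrow> real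
      \<Rightarrow> ('a \<times> 'c) list \<Rightarrow> ('a \<Rightarrow> 'b)"
  where "reg_minimizer \<H> ip loss lam D =
    (THE f. is_arg_min (reg_risk ip loss lam D) (\<lambda>f. f \<in> \<H>) f)"

definition sample :: "nat \<Rightarrow> (nat \<Rightarrow> 'a) \<Rightarrow> (nat \<Rightarrow> 'c) \<Rightarrow> ('a \<times> 'c) list"
  where "sample n X Y = map (\<lambda>i. (X i, Y i)) [1..<n + 1]"

definition augmented_sample :: "nat \<Rightarrow> (nat \<Rightarrow> 'a) \<Rightarrow> (nat \<Rightarrow> 'c) \<Rightarrow> 'c \<Rightarrow> ('a \<times> 'c) list"
  where "augmented_sample n X Y y = sample n X Y @ [(X (n + 1), y)]"

end

(* The two objectives, the second one rescaled by n/(n+1), differ only by the term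
   loss y (f (X (n+1))) / (n+1).  A convex functional plus lam * norm^2 exceeds its minimum by
   at least lam times the squared distance to the minimizer; adding this growth estimate for
   both objectives bounds 2 * lam * norm(f - g)^2 by the variation of the extra term, which the
   Lipschitz property and the reproducing property bound linearly in norm(f - g).
   Existence of the minimizers: by the parallelogram law minimizing sequences are Cauchy. *)

theory Submission imports Defs begin

section \<open>Inner product and norm calculus in a Hilbert space of extensional functions\<close>

context function_hilbert_space
begin

text \<open>Restriction to \<open>\<X>\<close> keeps the result extensional, hence inside
  \<open>\<H>\<close>. One operation with two free coefficients serves differences, convex
  combinations and the Cauchy-Schwarz witness, so a single expansion of the inner product covers
  them all.\<close>

definition lin_comb :: "real \<Rightarrow> real \<Rightarrow> ('a \<Rightarrow> 'b) \<Rightarrow> ('a \<Rightarrow> 'b) \<Rightarrow> ('a \<Rightarrow> 'b)"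
  where "lin_comb a b f g = (\<lambda>x\<in>\<X>. a *\<^sub>R f x + b *\<^sub>R g x)"

lemma lin_comb_eq_add_scale:
  "lin_comb a b f g = (\<lambda>x\<in>\<X>. (\<lambda>x\<in>\<X>. a *\<^sub>R f x) x + (\<lambda>x\<in>\<X>. b *\<^sub>R g x) x)"
  by (auto simp: lin_comb_def fun_eq_iff)

lemma lin_comb_closed: "f \<in> \<H> \<Longrightarrow> g \<in> \<H> \<Longrightarrow> lin_comb a b f g \<in> \<H>"
  unfolding lin_comb_eq_add_scale by (intro add_closed scale_closed)

lemma fdiff_eq_lin_comb: "fdiff \<X> f g = lin_comb 1 (-1) f g"
  by (simp add: fdiff_def lin_comb_def fun_eq_iff)

lemma fdiff_closed: "f \<in> \<H> \<Longrightarrow> g \<in> \<H> \<Longrightarrow> fdiff \<X> f g \<in> \<H>"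
  by (simp add: fdiff_eq_lin_comb lin_comb_closed)

lemma ip_lin_comb_left:
  assumes "f \<in> \<H>" "g \<in> \<H>" "h \<in> \<H>"
  shows "ip (lin_comb a b f g) h = a * ip f h + b * ip g h"
  unfolding lin_comb_eq_add_scale using assms
  by (simp only: ip_add scale_closed ip_scale)

lemma ip_lin_comb_self:
  assumes "f \<in> \<H>" "g \<in> \<H>"
  shows "ip (lin_comb a b f g) (lin_comb a b f g)
    = a\<^sup>2 * ip f f + 2 * a * b * ip f g + b\<^sup>2 * ip g g"
proof -
  have "ip f (lin_comb a b f g) = a * ip f f + b * ip f g"
       "ip g (lin_comb a b f g) = a * ip f g + b * ip g g"
    using assms by (simp_all add: ip_commute[of _ "lin_comb a b f g"] lin_comb_closed
        ip_lin_comb_left ip_commute[of g f])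
  then show ?thesis
    using assms by (simp add: ip_lin_comb_left lin_comb_closed power2_eq_square algebra_simps)
qed

lemma hnorm_sq: "f \<in> \<H> \<Longrightarrow> (hnorm ip f)\<^sup>2 = ip f f"
  by (simp add: hnorm_def ip_nonneg)

lemma hnorm_nonneg: "f \<in> \<H> \<Longrightarrow> 0 \<le> hnorm ip f"
  by (simp add: hnorm_def ip_nonneg)

lemma hnorm_fdiff_sq:
  assumes "f \<in> \<H>" "g \<in> \<H>"
  shows "(hnorm ip (fdiff \<X> f g))\<^sup>2 = ip f f - 2 * ip f g + ip g g"
  using assms by (simp add: hnorm_sq fdiff_closed)
    (simp add: fdiff_eq_lin_comb ip_lin_comb_self)

lemma hnorm_fdiff_commute:
  "f \<in> \<H> \<Longrightarrow> g \<in> \<H> \<Longrightarrow> hnorm ip (fdiff \<X> f g) = hnorm ip (fdiff \<X> g f)"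
  by (simp add: hnorm_def fdiff_eq_lin_comb ip_lin_comb_self ip_commute[of g f])

text \<open>Definiteness only yields agreement on \<open>\<X>\<close>; since members of
  \<open>\<H>\<close> are extensional, this is already equality of functions. Uniqueness of
  minimizers rests on it.\<close>

lemma hnorm_fdiff_eq_0D:
  assumes "f \<in> \<H>" "g \<in> \<H>" "hnorm ip (fdiff \<X> f g) = 0"
  shows "f = g"
proof -
  have "fdiff \<X> f g = (\<lambda>x\<in>\<X>. 0)"
    using assms fdiff_closed[OF assms(1,2)] hnorm_sq[of "fdiff \<X> f g"]
    by (intro ip_definite) auto
  then have "f x = g x" if "x \<in> \<X>" for x
    using that by (auto simp: fdiff_def fun_eq_iff dest!: spec[of _ x])
  then show ?thesis
    using assms(1,2) carrier by (intro PiE_ext[of f \<X> "\<lambda>_. UNIV" g]) auto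
qed

text \<open>The vector with coefficients \<open>ip g g\<close> and \<open>- ip f g\<close> is
  \<open>ip g g\<close> times the component of \<open>f\<close> orthogonal to \<open>g\<close>. Its
  squared norm is \<open>ip g g\<close> times the Gram determinant, which is therefore
  nonnegative.\<close>

lemma ip_Cauchy_Schwarz:
  assumes f: "f \<in> \<H>" and g: "g \<in> \<H>"
  shows "\<bar>ip f g\<bar> \<le> hnorm ip f * hnorm ip g"
proof (cases "ip g g = 0")
  case True
  then have "g = (\<lambda>x\<in>\<X>. 0)"
    using g ip_definite by blast
  \<comment> \<open>Writing the zero function as a trivial combination lets linearity show that its
    inner product with \<open>f\<close> vanishes.\<close>
  then have "lin_comb 0 0 f f = g"
    by (simp add: lin_comb_def)
  then have "ip g f = 0"
    using ip_lin_comb_left[OF f f f, of 0 0] by simp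
  then show ?thesis
    using True f g by (simp add: hnorm_def ip_commute[of f g])
next
  case False
  then have pos: "ip g g > 0"
    using ip_nonneg[OF g] by simp
  have "0 \<le> ip (lin_comb (ip g g) (- ip f g) f g) (lin_comb (ip g g) (- ip f g) f g)"
    using f g by (simp add: ip_nonneg lin_comb_closed)
  also have "\<dots> = ip g g * (ip f f * ip g g - (ip f g)\<^sup>2)"
    by (simp only: ip_lin_comb_self[OF f g]) (simp add: power2_eq_square algebra_simps)
  finally have "(ip f g)\<^sup>2 \<le> ip f f * ip g g"
    using pos by (simp add: zero_le_mult_iff)
  then have "sqrt ((ip f g)\<^sup>2) \<le> sqrt (ip f f * ip g g)"
    by (rule real_sqrt_le_mono)
  then show ?thesis
    by (simp add: hnorm_def real_sqrt_mult)
qed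

text \<open>This is the exact form of strong convexity of the squared norm; \<open>t = 1/2\<close>
  is the parallelogram law.\<close>

lemma hnorm_sq_convex_comb:
  assumes "f \<in> \<H>" "g \<in> \<H>"
  shows "(hnorm ip (lin_comb (1 - t) t f g))\<^sup>2
    = (1 - t) * (hnorm ip f)\<^sup>2 + t * (hnorm ip g)\<^sup>2 - t * (1 - t) * (hnorm ip (fdiff \<X> f g))\<^sup>2"
proof -
  have "(hnorm ip (lin_comb (1 - t) t f g))\<^sup>2
      = (1 - t)\<^sup>2 * ip f f + 2 * (1 - t) * t * ip f g + t\<^sup>2 * ip g g"
    using assms by (simp add: hnorm_sq lin_comb_closed ip_lin_comb_self)
  also have "\<dots> = (1 - t) * ip f f + t * ip g g - t * (1 - t) * (ip f f - 2 * ip f g + ip g g)"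
    by (simp add: power2_eq_square algebra_simps)
  finally show ?thesis
    using assms by (simp add: hnorm_fdiff_sq hnorm_sq)
qed

text \<open>Expand the square of \<open>s k\<close> around \<open>f\<close>: the quadratic term
  tends to 0 by assumption and the cross term by Cauchy-Schwarz.\<close>

lemma hnorm_sq_tendsto:
  assumes s: "\<And>k. s k \<in> \<H>" and f: "f \<in> \<H>"
    and lim: "(\<lambda>k. hnorm ip (fdiff \<X> (s k) f)) \<longlonglongrightarrow> 0"
  shows "(\<lambda>k. (hnorm ip (s k))\<^sup>2) \<longlonglongrightarrow> (hnorm ip f)\<^sup>2"
proof -
  let ?d = "\<lambda>k. fdiff \<X> (s k) f"
  have "(\<lambda>k. ip (?d k) f) \<longlonglongrightarrow> 0"
  proof (rule Lim_null_comparison)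
    show "\<forall>\<^sub>F k in sequentially. norm (ip (?d k) f) \<le> hnorm ip (?d k) * hnorm ip f"
      using ip_Cauchy_Schwarz fdiff_closed s f by simp
    show "(\<lambda>k. hnorm ip (?d k) * hnorm ip f) \<longlonglongrightarrow> 0"
      using tendsto_mult[OF lim tendsto_const[of "hnorm ip f"]] by simp
  qed
  then have "(\<lambda>k. (hnorm ip (?d k))\<^sup>2 + 2 * ip (?d k) f + (hnorm ip f)\<^sup>2)
      \<longlonglongrightarrow> 0\<^sup>2 + 2 * 0 + (hnorm ip f)\<^sup>2"
    by (intro tendsto_intros lim)
  moreover have "(hnorm ip (?d k))\<^sup>2 + 2 * ip (?d k) f + (hnorm ip f)\<^sup>2 = (hnorm ip (s k))\<^sup>2" for k
    using s f by (simp add: hnorm_fdiff_sq hnorm_sq)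
      (simp add: fdiff_eq_lin_comb ip_lin_comb_left)
  ultimately show ?thesis
    by simp
qed

section \<open>Minimization of a convex functional plus a multiple of the squared norm\<close>

definition convex_functional :: "(('a \<Rightarrow> 'b) \<Rightarrow> real) \<Rightarrow> bool"
  where "convex_functional \<Phi> \<longleftrightarrow> (\<forall>f\<in>\<H>. \<forall>g\<in>\<H>. \<forall>t\<in>{0..1}.
    \<Phi> (lin_comb (1 - t) t f g) \<le> (1 - t) * \<Phi> f + t * \<Phi> g)"

lemma regularized_convex_comb:
  assumes "convex_functional \<Phi>" "f \<in> \<H>" "g \<in> \<H>" "t \<in> {0..1}"
  shows "\<Phi> (lin_comb (1 - t) t f g) + \<mu> * (hnorm ip (lin_comb (1 - t) t f g))\<^sup>2
    \<le> (1 - t) * (\<Phi> f + \<mu> * (hnorm ip f)\<^sup>2) + t * (\<Phi> g + \<mu> * (hnorm ip g)\<^sup>2)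
      - \<mu> * t * (1 - t) * (hnorm ip (fdiff \<X> f g))\<^sup>2"
proof -
  have "\<Phi> (lin_comb (1 - t) t f g) \<le> (1 - t) * \<Phi> f + t * \<Phi> g"
    using assms unfolding convex_functional_def by blast
  then show ?thesis
    using assms(2,3) by (simp add: hnorm_sq_convex_comb algebra_simps)
qed

text \<open>Compare \<open>f\<close> with the points of the segment from \<open>f\<close> to
  \<open>g\<close>. Minimality bounds the objective there from below and strong convexity from
  above; after division by \<open>t\<close> only a factor \<open>1 - t\<close> separates the
  estimate from the claim.\<close>

lemma quadratic_growth:
  assumes conv: "convex_functional \<Phi>"
    and min: "is_arg_min (\<lambda>f. \<Phi> f + \<mu> * (hnorm ip f)\<^sup>2) (\<lambda>f. f \<in> \<H>) f" and g: "g \<in> \<H>"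
  shows "\<Phi> f + \<mu> * (hnorm ip f)\<^sup>2 + \<mu> * (hnorm ip (fdiff \<X> f g))\<^sup>2 \<le> \<Phi> g + \<mu> * (hnorm ip g)\<^sup>2"
proof -
  define J where "J = (\<lambda>f. \<Phi> f + \<mu> * (hnorm ip f)\<^sup>2)"
  define d where "d = (hnorm ip (fdiff \<X> f g))\<^sup>2"
  have le: "J f \<le> J h" if "h \<in> \<H>" for h
    using min that by (auto simp: is_arg_min_linorder J_def)
  have f: "f \<in> \<H>"
    using min by (simp add: is_arg_min_def)
  have step: "J f + \<mu> * (1 - t) * d \<le> J g" if t: "0 < t" "t < 1" for t
  proof -
    have "J f \<le> (1 - t) * J f + t * J g - \<mu> * t * (1 - t) * d"
      using le[OF lin_comb_closed[OF f g, of "1 - t" t]]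
        regularized_convex_comb[OF conv f g, of t \<mu>] t
      unfolding J_def d_def by simp
    then have "t * (J f + \<mu> * (1 - t) * d) \<le> t * J g"
      by (simp add: algebra_simps)
    then show ?thesis
      using t(1) by simp
  qed
  \<comment> \<open>Letting \<open>t\<close> tend to 0 from the right recovers the full constant
    \<open>\<mu>\<close>; the midpoint alone would give half of it.\<close>
  have "((\<lambda>t. J f + \<mu> * (1 - t) * d) \<longlongrightarrow> J f + \<mu> * (1 - 0) * d) (at_right 0)"
    by (intro tendsto_intros)
  moreover have "\<forall>\<^sub>F t in at_right (0::real). J f + \<mu> * (1 - t) * d \<le> J g"
    unfolding eventually_at_right_field using step by (intro exI[of _ 1]) auto
  ultimately have "J f + \<mu> * (1 - 0) * d \<le> J g"
    by (rule tendsto_upperbound) simp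
  then show ?thesis
    by (simp add: J_def d_def)
qed

text \<open>A minimizing sequence is Cauchy by strong convexity, completeness supplies a limit, and
  norm continuity of \<open>\<Phi>\<close> makes the limit attain the infimum.\<close>

lemma regularized_ex1_minimizer:
  assumes conv: "convex_functional \<Phi>" and mu: "\<mu> > 0"
    and below: "\<And>f. f \<in> \<H> \<Longrightarrow> c \<le> \<Phi> f"
    and cont: "\<And>s f. (\<And>k::nat. s k \<in> \<H>) \<Longrightarrow> f \<in> \<H> \<Longrightarrow>
      (\<lambda>k. hnorm ip (fdiff \<X> (s k) f)) \<longlonglongrightarrow> 0 \<Longrightarrow> (\<lambda>k. \<Phi> (s k)) \<longlonglongrightarrow> \<Phi> f"
  shows "\<exists>!f. is_arg_min (\<lambda>f. \<Phi> f + \<mu> * (hnorm ip f)\<^sup>2) (\<lambda>f. f \<in> \<H>) f"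
proof -
  define J where "J = (\<lambda>f. \<Phi> f + \<mu> * (hnorm ip f)\<^sup>2)"
  define m where "m = Inf (J ` \<H>)"
  have "c \<le> J f" if "f \<in> \<H>" for f
    using below[OF that] mu by (simp add: J_def add_increasing2)
  then have bdd: "bdd_below (J ` \<H>)"
    by (intro bdd_belowI2[of \<H> c J])
  have m_le: "m \<le> J f" if "f \<in> \<H>" for f
    unfolding m_def using that bdd by (intro cInf_lower) auto
  \<comment> \<open>The zero function shows that \<open>\<H>\<close> is nonempty, so the infimum
    \<open>m\<close> can be approached.\<close>
  have "\<exists>f\<in>\<H>. J f < m + 1 / real (Suc k)" for k
    using cInf_lessD[of "J ` \<H>" "m + 1 / real (Suc k)"] zero_closed
    by (auto simp: m_def)
  then obtain s where s: "\<And>k. s k \<in> \<H>" and s_less: "\<And>k. J (s k) < m + 1 / real (Suc k)"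
    by metis
  \<comment> \<open>The value at the midpoint is at least \<open>m\<close>, so two functions with
    nearly minimal values are close. This gives both the Cauchy property and uniqueness.\<close>
  have mid: "\<mu> * (hnorm ip (fdiff \<X> f g))\<^sup>2 \<le> 2 * ((J f - m) + (J g - m))"
    if "f \<in> \<H>" "g \<in> \<H>" for f g
    using order_trans[OF m_le[OF lin_comb_closed[OF that], unfolded J_def]
        regularized_convex_comb[OF conv that, of "1/2" \<mu>]]
    by (simp add: J_def field_simps)
  have cauchy: "\<exists>N. \<forall>i\<ge>N. \<forall>j\<ge>N. hnorm ip (fdiff \<X> (s i) (s j)) < e" if e: "e > 0" for e
  proof -
    \<comment> \<open>By \<open>mid\<close>, two excesses below \<open>1 / real (Suc N)\<close>
      bound \<open>\<mu>\<close> times the squared distance by four times that quantity, hence the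
      division by 4.\<close>
    obtain N where N: "1 / real (Suc N) < \<mu> * e\<^sup>2 / 4"
      using nat_approx_posE[of "\<mu> * e\<^sup>2 / 4"] mu e by auto
    have "hnorm ip (fdiff \<X> (s i) (s j)) < e" if ij: "i \<ge> N" "j \<ge> N" for i j
    proof -
      have "1 / real (Suc i) \<le> 1 / real (Suc N)" "1 / real (Suc j) \<le> 1 / real (Suc N)"
        using ij by (auto intro!: divide_left_mono)
      then have "\<mu> * (hnorm ip (fdiff \<X> (s i) (s j)))\<^sup>2 < \<mu> * e\<^sup>2"
        using mid[OF s s, of i j] s_less[of i] s_less[of j] N by argo
      then show ?thesis
        using mu e by (simp add: power_less_imp_less_base)
    qed
    then show ?thesis by blast
  qed
  obtain f where f: "f \<in> \<H>" and lim: "(\<lambda>k. hnorm ip (fdiff \<X> (s k) f)) \<longlonglongrightarrow> 0"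
    using complete[OF s cauchy] by blast
  have "(\<lambda>k. J (s k)) \<longlonglongrightarrow> J f"
    unfolding J_def by (intro tendsto_intros cont s f lim hnorm_sq_tendsto)
  moreover have "(\<lambda>k. m + 1 / real (Suc k)) \<longlonglongrightarrow> m + 0"
    by (intro tendsto_intros LIMSEQ_inverse_real_of_nat[unfolded inverse_eq_divide])
  ultimately have "J f \<le> m"
    using s_less by (intro LIMSEQ_le[of "\<lambda>k. J (s k)" _ "\<lambda>k. m + 1 / real (Suc k)"])
      (auto intro: less_imp_le)
  then have min: "is_arg_min J (\<lambda>f. f \<in> \<H>) f"
    using f m_le by (force simp: is_arg_min_linorder)
  have "g = f" if g: "is_arg_min J (\<lambda>f. f \<in> \<H>) g" for g
  proof -
    have "g \<in> \<H>" "J g \<le> m"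
      using g f \<open>J f \<le> m\<close> by (auto simp: is_arg_min_linorder intro: order_trans)
    then have "\<mu> * (hnorm ip (fdiff \<X> g f))\<^sup>2 \<le> 0"
      using mid[of g f] f \<open>J f \<le> m\<close> by auto
    then have "hnorm ip (fdiff \<X> g f) = 0"
      using mu by (simp add: mult_le_0_iff)
    then show ?thesis
      using hnorm_fdiff_eq_0D f \<open>g \<in> \<H>\<close> by blast
  qed
  with min show ?thesis
    unfolding J_def by blast
qed

end

section \<open>Bounds on point evaluation from the reproducing property\<close>

context vector_valued_rkhs
begin

text \<open>Take the kernel section at \<open>x\<close> in the direction \<open>v = f x\<close>: its
  inner product with \<open>f\<close> is the squared norm of \<open>f x\<close>, and Cauchy-Schwarz
  applies. One factor \<open>norm (f x)\<close> is cancelled at the end, so \<open>f x = 0\<close>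
  is treated apart.\<close>

lemma norm_eval_le:
  assumes x: "x \<in> \<X>" and f: "f \<in> \<H>"
  shows "norm (f x) \<le> sqrt (onorm (\<lambda>v. K x x *v v)) * hnorm ip f"
proof (cases "f x = 0")
  case True
  then show ?thesis
    using hnorm_nonneg[OF f] onorm_pos_le[of "\<lambda>v. K x x *v v"] by simp
next
  case False
  define L where "L = onorm (\<lambda>v. K x x *v v)"
  define k where "k = (\<lambda>z\<in>\<X>. K z x *v f x)"
  have k: "k \<in> \<H>"
    using kernel_in x by (simp add: k_def)
  \<comment> \<open>The reproducing property is applied to the kernel section \<open>k\<close>
    itself.\<close>
  have "(hnorm ip k)\<^sup>2 = f x \<bullet> (K x x *v f x)"
    using reproducing[OF x k] x by (simp add: hnorm_sq[OF k]) (simp add: k_def)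
  also have "\<dots> \<le> norm (f x) * norm (K x x *v f x)"
    by (rule norm_cauchy_schwarz)
  also have "\<dots> \<le> norm (f x) * (L * norm (f x))"
    unfolding L_def by (intro mult_left_mono onorm matrix_vector_mul_bounded_linear) auto
  also have "\<dots> = L * (norm (f x))\<^sup>2"
    by (simp add: power2_eq_square)
  finally have "hnorm ip k \<le> sqrt (L * (norm (f x))\<^sup>2)"
    by (rule real_le_rsqrt)
  then have hk: "hnorm ip k \<le> sqrt L * norm (f x)"
    by (simp add: real_sqrt_mult)
  have "norm (f x) * norm (f x) = ip k f"
    using reproducing[OF x f] by (simp add: k_def dot_square_norm power2_eq_square)
  also have "\<dots> \<le> hnorm ip k * hnorm ip f"
    using ip_Cauchy_Schwarz[OF k f] by linarith
  also have "\<dots> \<le> (sqrt L * norm (f x)) * hnorm ip f"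
    by (intro mult_right_mono hk hnorm_nonneg f)
  also have "\<dots> = norm (f x) * (sqrt L * hnorm ip f)"
    by simp
  finally show ?thesis
    using False by (simp add: L_def)
qed

text \<open>Applying the evaluation bound to \<open>s k - f\<close> turns norm convergence into
  pointwise convergence; continuity of the loss then passes to the empirical risk.\<close>

lemma eval_tendsto:
  assumes s: "\<And>k::nat. s k \<in> \<H>" and f: "f \<in> \<H>" and x: "x \<in> \<X>"
    and lim: "(\<lambda>k. hnorm ip (fdiff \<X> (s k) f)) \<longlonglongrightarrow> 0"
  shows "(\<lambda>k. s k x) \<longlonglongrightarrow> f x"
proof (rule LIM_zero_cancel, rule Lim_null_comparison)
  let ?c = "sqrt (onorm (\<lambda>v. K x x *v v))"
  show "\<forall>\<^sub>F k in sequentially. norm (s k x - f x) \<le> ?c * hnorm ip (fdiff \<X> (s k) f)"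
    using norm_eval_le[OF x fdiff_closed[OF s f]] x by (simp add: fdiff_def)
  show "(\<lambda>k. ?c * hnorm ip (fdiff \<X> (s k) f)) \<longlonglongrightarrow> 0"
    using tendsto_mult[OF tendsto_const lim] by simp
qed

section \<open>Convexity, continuity and lower bound of the summed loss\<close>

lemma sum_loss_convex_comb:
  assumes "set D \<subseteq> \<X> \<times> \<Y>" and "\<And>y. y \<in> \<Y> \<Longrightarrow> convex_on UNIV (loss y)"
    and "t \<in> {0..1}"
  shows "(\<Sum>(x, y)\<leftarrow>D. loss y (lin_comb (1 - t) t f g x))
    \<le> (1 - t) * (\<Sum>(x, y)\<leftarrow>D. loss y (f x)) + t * (\<Sum>(x, y)\<leftarrow>D. loss y (g x))"
  using assms(1)
proof (induction D)
  case (Cons p D)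
  obtain x y where p: "p = (x, y)" "x \<in> \<X>" "y \<in> \<Y>"
    using Cons.prems by (cases p) auto
  have "loss y (lin_comb (1 - t) t f g x) \<le> (1 - t) * loss y (f x) + t * loss y (g x)"
    using convex_onD[OF assms(2)[OF p(3)], of t "f x" "g x"] assms(3) p
    by (simp add: lin_comb_def)
  then show ?case
    using Cons by (simp add: p(1) algebra_simps)
qed simp

lemma sum_loss_tendsto:
  fixes loss :: "'c \<Rightarrow> real ^ 'p \<Rightarrow> real"
  assumes "set D \<subseteq> \<X> \<times> \<Y>" and "\<And>y. y \<in> \<Y> \<Longrightarrow> continuous_on UNIV (loss y)"
    and "\<And>x. x \<in> \<X> \<Longrightarrow> (\<lambda>k::nat. s k x) \<longlonglongrightarrow> f x"
  shows "(\<lambda>k. \<Sum>(x, y)\<leftarrow>D. loss y (s k x)) \<longlonglongrightarrow> (\<Sum>(x, y)\<leftarrow>D. loss y (f x))"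
  using assms(1)
proof (induction D)
  case (Cons p D)
  obtain x y where p: "p = (x, y)" "x \<in> \<X>" "y \<in> \<Y>"
    using Cons.prems by (cases p) auto
  have "(\<lambda>k. loss y (s k x)) \<longlonglongrightarrow> loss y (f x)"
    using continuous_on_tendsto_compose[OF assms(2)[OF p(3)] assms(3)[OF p(2)]] by simp
  then show ?case
    using Cons by (auto simp: p(1) intro!: tendsto_add)
qed simp

lemma sum_loss_ge:
  assumes "\<And>y u. c \<le> loss y u"
  shows "real (length D) * c \<le> (\<Sum>(x, y)\<leftarrow>D. loss y (f x))"
proof (induction D)
  case (Cons p D)
  then show ?case
    using assms[of "snd p" "f (fst p)"] by (simp add: case_prod_unfold algebra_simps)
qed simp

lemma convex_functional_sum_loss:
  assumes "set D \<subseteq> \<X> \<times> \<Y>" and "\<And>y. y \<in> \<Y> \<Longrightarrow> convex_on UNIV (loss y)" and "0 \<le> a"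
  shows "convex_functional (\<lambda>f. a * (\<Sum>(x, y)\<leftarrow>D. loss y (f x)))"
  unfolding convex_functional_def
proof (intro ballI)
  fix f g and t :: real
  assume "t \<in> {0..1}"
  then have "(\<Sum>(x, y)\<leftarrow>D. loss y (lin_comb (1 - t) t f g x))
      \<le> (1 - t) * (\<Sum>(x, y)\<leftarrow>D. loss y (f x)) + t * (\<Sum>(x, y)\<leftarrow>D. loss y (g x))"
    using assms(1,2) by (intro sum_loss_convex_comb) auto
  from mult_left_mono[OF this assms(3)]
  show "a * (\<Sum>(x, y)\<leftarrow>D. loss y (lin_comb (1 - t) t f g x))
      \<le> (1 - t) * (a * (\<Sum>(x, y)\<leftarrow>D. loss y (f x))) + t * (a * (\<Sum>(x, y)\<leftarrow>D. loss y (g x)))"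
    by (simp add: algebra_simps)
qed

text \<open>\<open>reg_minimizer\<close> is a definite description, so its minimality becomes
  available only through existence and uniqueness.\<close>

lemma reg_minimizer_is_arg_min:
  assumes D: "set D \<subseteq> \<X> \<times> \<Y>" and conv: "\<And>y. y \<in> \<Y> \<Longrightarrow> convex_on UNIV (loss y)"
    and cont: "\<And>y. y \<in> \<Y> \<Longrightarrow> continuous_on UNIV (loss y)"
    and below: "\<And>y u. c \<le> loss y u" and lam: "lam > 0"
  shows "is_arg_min (reg_risk ip loss lam D) (\<lambda>f. f \<in> \<H>) (reg_minimizer \<H> ip loss lam D)"
  unfolding reg_minimizer_def
proof (rule theI'[of "is_arg_min (reg_risk ip loss lam D) (\<lambda>f. f \<in> \<H>)"])
  let ?\<Phi> = "\<lambda>f. (1 / real (length D)) * (\<Sum>(x, y)\<leftarrow>D. loss y (f x))"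
  have "\<exists>!f. is_arg_min (\<lambda>f. ?\<Phi> f + lam * (hnorm ip f)\<^sup>2) (\<lambda>f. f \<in> \<H>) f"
  proof (rule regularized_ex1_minimizer)
    show "convex_functional ?\<Phi>"
      using D conv by (intro convex_functional_sum_loss) auto
    \<comment> \<open>The bound equals \<open>c\<close> for nonempty \<open>D\<close> and 0 for the
      empty list, where \<open>1 / 0 = 0\<close>; left unsimplified, it covers both cases.\<close>
    show "(1 / real (length D)) * (real (length D) * c) \<le> ?\<Phi> f" for f
      by (intro mult_left_mono sum_loss_ge below) auto
    show "(\<lambda>k. ?\<Phi> (s k)) \<longlonglongrightarrow> ?\<Phi> f"
      if "\<And>k::nat. s k \<in> \<H>" "f \<in> \<H>" "(\<lambda>k. hnorm ip (fdiff \<X> (s k) f)) \<longlonglongrightarrow> 0" for s f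
      using that D cont by (intro tendsto_mult_left sum_loss_tendsto eval_tendsto) auto
  qed (rule lam)
  then show "\<exists>!f. is_arg_min (reg_risk ip loss lam D) (\<lambda>f. f \<in> \<H>) f"
    by (simp add: reg_risk_def[abs_def])
qed

lemma reg_risk_quadratic_growth:
  assumes "set D \<subseteq> \<X> \<times> \<Y>" and "\<And>y. y \<in> \<Y> \<Longrightarrow> convex_on UNIV (loss y)"
    and "is_arg_min (reg_risk ip loss lam D) (\<lambda>f. f \<in> \<H>) f" and "g \<in> \<H>"
  shows "reg_risk ip loss lam D f + lam * (hnorm ip (fdiff \<X> f g))\<^sup>2 \<le> reg_risk ip loss lam D g"
proof -
  have "convex_functional (\<lambda>f. (1 / real (length D)) * (\<Sum>(x, y)\<leftarrow>D. loss y (f x)))"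
    using assms(1,2) by (intro convex_functional_sum_loss) auto
  from quadratic_growth[OF this assms(3)[unfolded reg_risk_def[abs_def]] assms(4)]
  show ?thesis
    unfolding reg_risk_def .
qed

section \<open>Effect of one additional data point on the minimizer\<close>

lemma reg_minimizer_add_point:
  assumes D: "set D \<subseteq> \<X> \<times> \<Y>" "D \<noteq> []" and x: "x \<in> \<X>" and y: "y \<in> \<Y>"
    and conv: "\<And>y. y \<in> \<Y> \<Longrightarrow> convex_on UNIV (loss y)"
    and lip: "\<And>y. y \<in> \<Y> \<Longrightarrow> \<rho>-lipschitz_on UNIV (loss y)"
    and below: "\<And>y u. c \<le> loss y u" and lam: "lam > 0"
  defines "n \<equiv> real (length D)"
  shows "hnorm ip (fdiff \<X> (reg_minimizer \<H> ip loss lam (D @ [(x, y)]))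
                          (reg_minimizer \<H> ip loss ((n + 1) / n * lam) D))
    \<le> \<rho> * sqrt (onorm (\<lambda>v. K x x *v v)) / (2 * lam * (n + 1))"
proof -
  define f where "f = reg_minimizer \<H> ip loss lam (D @ [(x, y)])"
  define g where "g = reg_minimizer \<H> ip loss ((n + 1) / n * lam) D"
  define S where "S = (\<lambda>h. \<Sum>(x, y)\<leftarrow>D. loss y (h x))"
  define d where "d = hnorm ip (fdiff \<X> f g)"
  define L where "L = sqrt (onorm (\<lambda>v. K x x *v v))"
  have n: "n > 0"
    using D by (simp add: n_def)
  have cont: "continuous_on UNIV (loss y)" if "y \<in> \<Y>" for y
    using lip[OF that] by (rule lipschitz_on_continuous_on)
  have Dy: "set (D @ [(x, y)]) \<subseteq> \<X> \<times> \<Y>"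
    using D x y by simp
  have f_min: "is_arg_min (reg_risk ip loss lam (D @ [(x, y)])) (\<lambda>f. f \<in> \<H>) f"
    unfolding f_def using reg_minimizer_is_arg_min[OF Dy conv cont below lam] by simp
  have g_min: "is_arg_min (reg_risk ip loss ((n + 1) / n * lam) D) (\<lambda>f. f \<in> \<H>) g"
    unfolding g_def using n lam by (intro reg_minimizer_is_arg_min[OF D(1) conv cont below]) auto
  have f: "f \<in> \<H>" and g: "g \<in> \<H>"
    using f_min g_min by (auto simp: is_arg_min_def)
  \<comment> \<open>This clears the averaging factor \<open>1 / m\<close>, so that both growth
    estimates contain the plain sum \<open>S\<close> over the common data.\<close>
  have clear: "a + m * u \<le> b + m * v" if "1 / m * a + u \<le> 1 / m * b + v" "m > 0" for a b u v m :: real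
    using mult_left_mono[OF that(1), of m] that(2) by (simp add: distrib_left)
  have "1 / (n + 1) * (S f + loss y (f x)) + (lam * (hnorm ip f)\<^sup>2 + lam * d\<^sup>2)
      \<le> 1 / (n + 1) * (S g + loss y (g x)) + lam * (hnorm ip g)\<^sup>2"
    using reg_risk_quadratic_growth[OF Dy conv f_min g]
    by (simp add: reg_risk_def S_def d_def n_def add_ac)
  from clear[OF this]
  have 1: "S f + loss y (f x) + (n + 1) * (lam * (hnorm ip f)\<^sup>2 + lam * d\<^sup>2)
      \<le> S g + loss y (g x) + (n + 1) * (lam * (hnorm ip g)\<^sup>2)"
    using n by simp
  \<comment> \<open>Multiplied by \<open>n\<close>, the parameter \<open>(n + 1) / n * lam\<close>
    becomes \<open>(n + 1) * lam\<close>, the same coefficient as in \<open>1\<close>; this is the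
    purpose of the modified regularization.\<close>
  have "1 / n * S g + ((n + 1) / n * lam * (hnorm ip g)\<^sup>2 + (n + 1) / n * lam * d\<^sup>2)
      \<le> 1 / n * S f + (n + 1) / n * lam * (hnorm ip f)\<^sup>2"
    using reg_risk_quadratic_growth[OF D(1) conv g_min f]
    by (simp add: reg_risk_def S_def d_def n_def hnorm_fdiff_commute[OF f g])
  from clear[OF this n]
  have 2: "S g + (n + 1) * lam * ((hnorm ip g)\<^sup>2 + d\<^sup>2) \<le> S f + (n + 1) * lam * (hnorm ip f)\<^sup>2"
    using n by (simp add: distrib_left)
  \<comment> \<open>In the sum of \<open>1\<close> and \<open>2\<close> the terms in
    \<open>S\<close> and the squared norms of \<open>f\<close> and \<open>g\<close> cancel; each
    estimate contributes one copy of the squared distance.\<close>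
  have "2 * lam * (n + 1) * d\<^sup>2 \<le> loss y (g x) - loss y (f x)"
    using 1 2 by (simp add: algebra_simps)
  also have "\<dots> \<le> \<rho> * norm (f x - g x)"
    using lipschitz_onD[OF lip[OF y], of "f x" "g x"] by (simp add: dist_norm)
  also have "\<dots> \<le> \<rho> * (L * d)"
    using norm_eval_le[OF x fdiff_closed[OF f g]] x lipschitz_on_nonneg[OF lip[OF y]]
    by (intro mult_left_mono) (simp_all add: L_def d_def fdiff_def)
  finally have main: "d * (d * (2 * lam * (n + 1))) \<le> d * (\<rho> * L)"
    by (simp add: power2_eq_square algebra_simps)
  have "d \<ge> 0" "L \<ge> 0" "\<rho> \<ge> 0"
    using hnorm_nonneg[OF fdiff_closed[OF f g]] lipschitz_on_nonneg[OF lip[OF y]]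
    by (simp_all add: d_def L_def onorm_pos_le)
  \<comment> \<open>A factor \<open>d\<close> is cancelled from \<open>main\<close>; if
    \<open>d = 0\<close>, the claim is nonnegativity of the right-hand side.\<close>
  then have "d * (2 * lam * (n + 1)) \<le> \<rho> * L"
    using main by (cases "d = 0") simp_all
  then show ?thesis
    using lam n by (simp add: d_def f_def g_def L_def pos_le_divide_eq)
qed

end

theorem mainTheorem3:
  fixes \<X> :: "(real ^ 'd) set"
    and \<Y> :: "(real ^ 'p) set"
    and \<H> :: "(real ^ 'd \<Rightarrow> real ^ 'p) set"
    and ip :: "(real ^ 'd \<Rightarrow> real ^ 'p) \<Rightarrow> (real ^ 'd \<Rightarrow> real ^ 'p) \<Rightarrow> real"
    and K :: "real ^ 'd \<Rightarrow> real ^ 'd \<Rightarrow> real ^ 'p ^ 'p"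
    and loss :: "real ^ 'p \<Rightarrow> real ^ 'p \<Rightarrow> real"
    and n :: nat
    and X :: "nat \<Rightarrow> real ^ 'd"
    and Y :: "nat \<Rightarrow> real ^ 'p"
    and \<rho> c lam :: real
  assumes "vector_valued_rkhs \<X> \<H> ip K"
    and "n \<ge> 1"
    and "\<And>i. i \<in> {1..n + 1} \<Longrightarrow> X i \<in> \<X>"
    and "\<And>i. i \<in> {1..n} \<Longrightarrow> Y i \<in> \<Y>"
    and "\<And>y. y \<in> \<Y> \<Longrightarrow> convex_on UNIV (\<lambda>u. loss y u)"
    and "\<rho> > 0"
    and "\<And>y. y \<in> \<Y> \<Longrightarrow> \<rho>-lipschitz_on UNIV (\<lambda>u. loss y u)"
    and "\<And>y u. loss y u \<ge> c"
    and "lam > 0"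
  shows "\<forall>y\<in>\<Y>.
    hnorm ip (fdiff \<X> (reg_minimizer \<H> ip loss lam (augmented_sample n X Y y))
                     (reg_minimizer \<H> ip loss ((real n + 1) / real n * lam) (sample n X Y)))
      \<le> \<rho> * sqrt (onorm (\<lambda>v. K (X (n + 1)) (X (n + 1)) *v v)) / (2 * lam * (real n + 1))"
proof
  fix y assume y: "y \<in> \<Y>"
  interpret vector_valued_rkhs \<X> \<H> ip K by fact
  \<comment> \<open>The half-open range \<open>[1..<n + 1]\<close> has exactly \<open>n\<close>
    entries, and \<open>n \<ge> 1\<close> makes the list nonempty.\<close>
  have "length (sample n X Y) = n" "sample n X Y \<noteq> []"
    using assms(2) by (auto simp: sample_def)
  moreover have "set (sample n X Y) \<subseteq> \<X> \<times> \<Y>"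
    using assms(3,4) by (auto simp: sample_def)
  moreover have "X (n + 1) \<in> \<X>"
    using assms(3) by simp
  ultimately show "hnorm ip (fdiff \<X> (reg_minimizer \<H> ip loss lam (augmented_sample n X Y y))
                     (reg_minimizer \<H> ip loss ((real n + 1) / real n * lam) (sample n X Y)))
      \<le> \<rho> * sqrt (onorm (\<lambda>v. K (X (n + 1)) (X (n + 1)) *v v)) / (2 * lam * (real n + 1))"
    using reg_minimizer_add_point[of "sample n X Y" \<Y> "X (n + 1)" y loss \<rho> c lam] y assms(5,7,8,9)
    unfolding augmented_sample_def by simp
qed

end
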